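(* Let a user-to-base-station allocation, SINR requirements $\gamma_k>0$ and a penalty $\rho>0$ be fixed, and let $\mathcal{H}$ be the (compact) set of strictly $\gamma_k$-feasible channels under consideration. Given parameters $\boldsymbol{\tau}^{[i-1]}\in\mathbb{R}^{(B-1)K}$, $\boldsymbol{\nu}^{[i-1]}\in\mathbb{R}^{2(B-1)K}$ and a channel $\mathbf{H}\in\mathcal{H}$, let one ADMM iteration produce the primal solution $\mathbf{W}^{[i]},\mathbf{t}^{[i]}$ and the parameters $\boldsymbol{\tau}^{[i]},\boldsymbol{\nu}^{[i]}$. Then $\mathbf{W}^{[i]}$, $\mathbf{t}^{[i]}$, $\boldsymbol{\tau}^{[i]}$ and $\boldsymbol{\nu}^{[i]}$ are continuous functions of $\mathbf{H}$, $\boldsymbol{\tau}^{[i-1]}$ and $\boldsymbol{\nu}^{[i-1]}$.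
   Context: There are $B$ base stations with $N_T$ antennas each and $K$ single-antenna users. User $k$ is served by base station $b(k)$, and $\mathcal{U}(b)=\{k: b(k)=b\}$. $\mathbf{h}_{mk}\in\mathbb{C}^{N_T}$ is the channel from base station $m$ to user $k$, $\mathbf{H}$ is the collection of all $\mathbf{h}_{mk}$, $\mathbf{w}_k\in\mathbb{C}^{N_T}$ is the beam-former for user $k$, and $\mathbf{W}=(\mathbf{w}_1,\dots,\mathbf{w}_K)$. Noise variances $\sigma_k^2>0$ are fixed. Define $$\mathrm{SINR}_k(\mathbf{W},\mathbf{H})=\frac{|\mathbf{h}_{b(k)k}^H\mathbf{w}_k|^2}{\sum_{i\in\mathcal{U}(b(k))\setminus k}|\mathbf{h}_{b(k)k}^H\mathbf{w}_i|^2+\sum_{m\ne b(k)}\sum_{i\in\mathcal{U}(m)}|\mathbf{h}_{mk}^H\mathbf{w}_i|^2+\sigma_k^2}.$$ $\mathbf{H}$ is strictly $\gamma_k$-feasible if there is $\mathbf{W}$ with $\mathrm{SINR}_k(\mathbf{W},\mathbf{H})>\gamma_k$ for all $k$. Phase convention: beam-formers are normalized so that $\mathbf{h}_{b(k)k}^H\mathbf{w}_k$ is real and nonnegative (this makes the SINR constraints second-order cone constraints). For each user $k$ and each $m\ne b(k)$ there are two real copies $t_{mk}^{(m)}$ (held by $m$) and $t_{mk}^{(b(k))}$ (held by $b(k)$) of the interference amplitude caused by base station $m$ on user $k$, and one consistency variable $\tau_{mk}\in\mathbb{R}$. $\mathbf{t}_b$ collects the copies held by base station $b$, i.e. $t_{bj}^{(b)}$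 for $j\notin\mathcal{U}(b)$ and $t_{mk}^{(b)}$ for $k\in\mathcal{U}(b)$, $m\ne b$. $\mathbf{t}=(\mathbf{t}_1,\dots,\mathbf{t}_B)\in\mathbb{R}^{2(B-1)K}$ and $\boldsymbol{\tau}\in\mathbb{R}^{(B-1)K}$ collect everything. $\mathbf{E}$ is the $2(B-1)K\times(B-1)K$ zero-one matrix copying each $\tau_{mk}$ into the two positions of its copies in $\mathbf{t}$, $\mathbf{E}_b$ is its block of rows corresponding to $\mathbf{t}_b$, $\boldsymbol{\nu}=(\boldsymbol{\nu}_1,\dots,\boldsymbol{\nu}_B)$ is partitioned as $\mathbf{t}$, and $\mathbf{E}^\dagger$ is the pseudo-inverse of $\mathbf{E}$. One ADMM iteration with channels $\mathbf{H}$: (1) for each $b$, $(\{\mathbf{w}_k^{[i]}\}_{k\in\mathcal{U}(b)},\mathbf{t}_b^{[i]})$ is the minimizer of $\sum_{j\in\mathcal{U}(b)}\|\mathbf{w}_j\|^2+(\boldsymbol{\nu}_b^{[i-1]})^T(\mathbf{t}_b-\mathbf{E}_b\boldsymbol{\tau}^{[i-1]})+\frac{\rho}{2}\|\mathbf{t}_b-\mathbf{E}_b\boldsymbol{\tau}^{[i-1]}\|^2$ subject to (SINR) for $k\in\mathcal{U}(b)$: $|\mathbf{h}_{bk}^H\mathbf{w}_k|^2\ge\gamma_k\big(\sum_{l\in\mathcal{U}(b)\setminus k}|\mathbf{h}_{bk}^H\mathbf{w}_l|^2+\sum_{m\ne b}(t_{mk}^{(b)})^2+\sigma_k^2\big)$,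 and (INT) for $j\notin\mathcal{U}(b)$: $\big(\sum_{l\in\mathcal{U}(b)}|\mathbf{h}_{bj}^H\mathbf{w}_l|^2\big)^{1/2}\le t_{bj}^{(b)}$; (2) $\boldsymbol{\tau}^{[i]}=\mathbf{E}^\dagger\mathbf{t}^{[i]}$; (3) $\boldsymbol{\nu}_b^{[i]}=\boldsymbol{\nu}_b^{[i-1]}+\rho(\mathbf{t}_b^{[i]}-\mathbf{E}_b\boldsymbol{\tau}^{[i]})$ for each $b$. *)

theory Defs
  imports "HOL-Analysis.Analysis"
begin

text \<open>
  Base stations, users and antennas are indexed by the finite types \<open>'b\<close>, \<open>'k\<close> and \<open>'n\<close>, so
  \<open>B = CARD('b)\<close>, \<open>K = CARD('k)\<close> and \<open>N\<^sub>T = CARD('n)\<close>. The map \<open>bs\<close> sends a user to its serving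
  base station. A collection of channels has type \<open>complex^'n^'k^'b\<close>, with \<open>H $ m $ k\<close> the channel
  from base station \<open>m\<close> to user \<open>k\<close>.
\<close>

definition users :: "('k \<Rightarrow> 'b) \<Rightarrow> 'b \<Rightarrow> 'k set"
  where "users bs b = {k. bs k = b}"

definition hdot :: "complex^'n \<Rightarrow> complex^'n \<Rightarrow> complex"
  where "hdot h w = (\<Sum>i\<in>UNIV. cnj (h $ i) * w $ i)"

definition SINR ::
  "('k::finite \<Rightarrow> 'b::finite) \<Rightarrow> ('k \<Rightarrow> real) \<Rightarrow> 'k \<Rightarrow> complex^'n^'k \<Rightarrow> complex^'n^'k^'b \<Rightarrow> real"
  where "SINR bs \<sigma> k W H =
    (cmod (hdot (H $ bs k $ k) (W $ k)))\<^sup>2 /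
    ((\<Sum>i\<in>users bs (bs k) - {k}. (cmod (hdot (H $ bs k $ k) (W $ i)))\<^sup>2)
      + (\<Sum>m\<in>UNIV - {bs k}. \<Sum>i\<in>users bs m. (cmod (hdot (H $ m $ k) (W $ i)))\<^sup>2)
      + (\<sigma> k)\<^sup>2)"

definition strictly_feasible ::
  "('k::finite \<Rightarrow> 'b::finite) \<Rightarrow> ('k \<Rightarrow> real) \<Rightarrow> ('k \<Rightarrow> real) \<Rightarrow> complex^'n^'k^'b \<Rightarrow> bool"
  where "strictly_feasible bs \<gamma> \<sigma> H \<longleftrightarrow> (\<exists>W. \<forall>k. SINR bs \<sigma> k W H > \<gamma> k)"

text \<open>
  The index set \<open>links\<close> of the consistency variables depends on \<open>bs\<close> and is not a type, so
  \<open>\<real>\<^bsup>(B-1)K\<^esup>\<close> and \<open>\<real>\<^bsup>2(B-1)K\<^esup>\<close> are represented as coordinate subspaces of larger Euclidean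
  spaces: the coordinates outside the index sets \<open>links\<close> and \<open>copies\<close> are fixed to \<open>0\<close>.
  The variable \<open>\<tau>\<^sub>m\<^sub>k\<close> is \<open>\<tau> $ (m, k)\<close>, and the copy of the interference amplitude from \<open>m\<close> to \<open>k\<close>
  that is held by base station \<open>c\<close> is \<open>t $ (c, m, k)\<close>.
\<close>

definition links :: "('k \<Rightarrow> 'b) \<Rightarrow> ('b \<times> 'k) set"
  where "links bs = {(m, k). m \<noteq> bs k}"

definition copies :: "('k \<Rightarrow> 'b) \<Rightarrow> ('b \<times> 'b \<times> 'k) set"
  where "copies bs = {(c, m, k). m \<noteq> bs k \<and> (c = m \<or> c = bs k)}"

definition tau_space :: "('k::finite \<Rightarrow> 'b::finite) \<Rightarrow> (real^('b \<times> 'k)) set"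
  where "tau_space bs = {\<tau>. \<forall>p. p \<notin> links bs \<longrightarrow> \<tau> $ p = 0}"

definition t_space :: "('k::finite \<Rightarrow> 'b::finite) \<Rightarrow> (real^('b \<times> 'b \<times> 'k)) set"
  where "t_space bs = {t. \<forall>q. q \<notin> copies bs \<longrightarrow> t $ q = 0}"

text \<open>
  For a vector this is the sub-vector belonging to base station \<open>b\<close>, for a matrix (a vector of
  rows) the corresponding block of rows.
\<close>

definition block :: "'b \<Rightarrow> 'a^('b::finite \<times> 'p::finite) \<Rightarrow> 'a^'p"
  where "block b x = (\<chi> p. x $ (b, p))"

definition copy_matrix :: "('k::finite \<Rightarrow> 'b::finite) \<Rightarrow> real^('b \<times> 'k)^('b \<times> 'b \<times> 'k)"
  where "copy_matrix bs = (\<chi> q p. if q \<in> copies bs \<and> snd q = p then 1 else 0)"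

text \<open>
  The Moore-Penrose pseudo-inverse. The rows and columns of \<open>copy_matrix\<close> outside the index sets
  vanish, and the pseudo-inverse of a matrix padded by zeros is the padded pseudo-inverse.
\<close>

definition is_pseudo_inverse :: "real^'n^'m \<Rightarrow> real^'m^'n \<Rightarrow> bool"
  where "is_pseudo_inverse A X \<longleftrightarrow>
    A ** X ** A = A \<and> X ** A ** X = X \<and>
    transpose (A ** X) = A ** X \<and> transpose (X ** A) = X ** A"

definition pseudo_inverse :: "real^'n^'m \<Rightarrow> real^'m^'n"
  where "pseudo_inverse A = (THE X. is_pseudo_inverse A X)"

text \<open>
  The problem of base station \<open>b\<close> has the variables \<open>W $ k\<close> for \<open>k \<in> users bs b\<close> and
  \<open>tb\<close>; neither its constraints nor its cost involve the other entries of \<open>W\<close>. The first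
  constraint confines \<open>tb\<close> to the copies held by \<open>b\<close>. The second is the phase convention
  for the beam-formers: without it minimizers are unique only up to a phase per user.
\<close>

definition local_feasible ::
  "('k::finite \<Rightarrow> 'b::finite) \<Rightarrow> ('k \<Rightarrow> real) \<Rightarrow> ('k \<Rightarrow> real) \<Rightarrow> complex^'n^'k^'b \<Rightarrow> 'b \<Rightarrow>
   (complex^'n^'k) \<times> (real^('b \<times> 'k)) \<Rightarrow> bool"
  where "local_feasible bs \<gamma> \<sigma> H b = (\<lambda>(W, tb).
    (\<forall>p. (b, p) \<notin> copies bs \<longrightarrow> tb $ p = 0) \<and>
    (\<forall>k\<in>users bs b. hdot (H $ b $ k) (W $ k) \<in> \<real>\<^sub>\<ge>\<^sub>0) \<and>
    (\<forall>k\<in>users bs b. (cmod (hdot (H $ b $ k) (W $ k)))\<^sup>2 \<ge>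
      \<gamma> k * ((\<Sum>l\<in>users bs b - {k}. (cmod (hdot (H $ b $ k) (W $ l)))\<^sup>2)
        + (\<Sum>m\<in>UNIV - {b}. (tb $ (m, k))\<^sup>2) + (\<sigma> k)\<^sup>2)) \<and>
    (\<forall>j. j \<notin> users bs b \<longrightarrow>
      sqrt (\<Sum>l\<in>users bs b. (cmod (hdot (H $ b $ j) (W $ l)))\<^sup>2) \<le> tb $ (b, j)))"

definition local_cost ::
  "('k::finite \<Rightarrow> 'b::finite) \<Rightarrow> real \<Rightarrow> real^('b \<times> 'k) \<Rightarrow> real^('b \<times> 'b \<times> 'k) \<Rightarrow> 'b \<Rightarrow>
   (complex^'n^'k) \<times> (real^('b \<times> 'k)) \<Rightarrow> real"
  where "local_cost bs \<rho> \<tau> \<nu> b = (\<lambda>(W, tb).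
    (\<Sum>j\<in>users bs b. (norm (W $ j))\<^sup>2)
    + block b \<nu> \<bullet> (tb - block b (copy_matrix bs) *v \<tau>)
    + \<rho> / 2 * (norm (tb - block b (copy_matrix bs) *v \<tau>))\<^sup>2)"

definition admm_iteration ::
  "('k::finite \<Rightarrow> 'b::finite) \<Rightarrow> ('k \<Rightarrow> real) \<Rightarrow> ('k \<Rightarrow> real) \<Rightarrow> real \<Rightarrow>
   complex^'n^'k^'b \<Rightarrow> real^('b \<times> 'k) \<Rightarrow> real^('b \<times> 'b \<times> 'k) \<Rightarrow>
   complex^'n^'k \<Rightarrow> real^('b \<times> 'b \<times> 'k) \<Rightarrow> real^('b \<times> 'k) \<Rightarrow> real^('b \<times> 'b \<times> 'k) \<Rightarrow> bool"
  where "admm_iteration bs \<gamma> \<sigma> \<rho> H \<tau> \<nu> W t \<tau>' \<nu>' \<longleftrightarrow>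
    (\<forall>b. is_arg_min (local_cost bs \<rho> \<tau> \<nu> b) (local_feasible bs \<gamma> \<sigma> H b) (W, block b t)) \<and>
    \<tau>' = pseudo_inverse (copy_matrix bs) *v t \<and>
    (\<forall>b. block b \<nu>' = block b \<nu> + \<rho> *\<^sub>R (block b t - block b (copy_matrix bs) *v \<tau>'))"

end

theory Submission
  imports Defs
begin

text \<open>
  The local problems of one iteration have no variables in common, so solving all of them is the
  same as minimizing the sum of their costs over the joint feasible set of all beam-formers and all
  copies (\<open>local_minimizers_iff_joint_minimizer\<close>). After completing the square, that sum is a
  constant plus the squared distance, in suitably scaled coordinates, from a point that depends
  continuously on \<open>\<tau>\<close> and \<open>\<nu>\<close> (\<open>joint_cost_eq_dist\<close>). With the phase convention the constraints
  are second-order cone constraints, so the feasible set is closed and convex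
  (\<open>convex_joint_feasible\<close>), and it is nonempty for a strictly feasible channel. The primal step is
  hence the projection of a point onto a closed convex set that depends on the channel alone
  (\<open>local_minimizers_iff_projection\<close>). The two remaining steps are affine.

  A projection is jointly continuous in the point and the set if the set has a closed graph and is
  lower hemicontinuous in the parameter (\<open>closest_point_continuous_on_set_map\<close>). The closed graph is
  clear, all constraints being non-strict inequalities between continuous functions. Lower
  hemicontinuity means that a feasible point for \<open>H\<close> can be approximated by feasible points for all
  nearby channels (\<open>joint_feasible_lower_hemicontinuous\<close>). Scaling all variables up by \<open>1 + d\<close>
  makes every SINR constraint strict, because the noise is not scaled, and raising the copies held by
  the interfering base stations makes the leakage bounds strict. Strict inequalities persist under
  small changes of the channel. The phase convention is an equation and does not persist, but it can
  be restored by rotating each beam-former, which affects no other constraint and is a small change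
  because the desired signal stays away from zero.
\<close>

section \<open>Continuity of projections onto moving convex sets\<close>

text \<open>
  Lower hemicontinuity places points of the nearby sets close to the limiting projection, which
  bounds the distances from the targets to their projections. The projections therefore stay in a
  ball, and every cluster point of them lies in the limiting set by the closed graph and is at most
  as far from the target as the projection there. A convex set has only one such point.
\<close>

lemma closest_point_continuous_on_set_map:
  fixes K :: "'p::metric_space \<Rightarrow> 'x::euclidean_space set"
  assumes convex: "\<And>p. p \<in> D \<Longrightarrow> convex (K p)"
    and nonempty: "\<And>p. p \<in> D \<Longrightarrow> K p \<noteq> {}"
    and closed_graph: "\<And>p x pn xn. \<lbrakk>p \<in> D; \<And>n::nat. pn n \<in> D; \<And>n. xn n \<in> K (pn n);
          pn \<longlonglongrightarrow> p; xn \<longlonglongrightarrow> x\<rbrakk> \<Longrightarrow> x \<in> K p"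
    and lower: "\<And>p x e. \<lbrakk>p \<in> D; x \<in> K p; e > 0\<rbrakk> \<Longrightarrow>
          eventually (\<lambda>q. \<exists>y\<in>K q. dist y x < e) (at p within D)"
  shows "continuous_on (D \<times> UNIV) (\<lambda>(p, a). closest_point (K p) a)"
proof -
  have closed: "closed (K p)" if "p \<in> D" for p
    unfolding closed_sequential_limits using closed_graph[of p "\<lambda>_. p"] that by auto
  define P where "P = (\<lambda>p a. closest_point (K p) a)"
  have PK: "P p a \<in> K p" if "p \<in> D" for p a
    unfolding P_def using closest_point_in_set[OF closed nonempty] that by blast
  have Ple: "dist a (P p a) \<le> dist a y" if "p \<in> D" "y \<in> K p" for p a y
    unfolding P_def using closest_point_le[OF closed] that by blast
  have tends: "(\<lambda>n. P (pn n) (an n)) \<longlonglongrightarrow> P p a"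
    if pD: "p \<in> D" and pnD: "\<And>n. pn n \<in> D" and pn: "pn \<longlonglongrightarrow> p" and an: "an \<longlonglongrightarrow> a" for p a pn an
  proof -
    define x where "x = (\<lambda>n. P (pn n) (an n))"
    \<comment> \<open>Lower hemicontinuity supplies competitors, which bounds the distances from above in the limit.\<close>
    have near: "eventually (\<lambda>n. dist a (x n) < dist a (P p a) + e) sequentially" if e: "e > 0" for e
    proof -
      have L: "eventually (\<lambda>q. \<exists>y\<in>K q. dist y (P p a) < e/3) (at p within D)"
        using lower[OF pD PK[OF pD], of "e/3"] e by simp
      have "eventually (\<lambda>q. q \<in> D \<longrightarrow> (\<exists>y\<in>K q. dist y (P p a) < e/3)) (nhds p)"
        using L PK[OF pD, of a] e unfolding eventually_at_filter
        by (rule_tac eventually_mono) force+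
      then have 1: "eventually (\<lambda>n. \<exists>y\<in>K (pn n). dist y (P p a) < e/3) sequentially"
        using pn pnD by (force simp: filterlim_iff elim: eventually_mono)
      have 2: "eventually (\<lambda>n. dist (an n) a < e/3) sequentially"
        using an e tendstoD[of an a sequentially "e/3"] by simp
      show ?thesis
        using 1 2
      proof eventually_elim
        case (elim n)
        then obtain y where y: "y \<in> K (pn n)" "dist y (P p a) < e/3" by blast
        have "dist a (x n) \<le> dist a (an n) + dist (an n) (x n)" by (rule dist_triangle)
        also have "dist (an n) (x n) \<le> dist (an n) y"
          unfolding x_def using Ple[OF pnD y(1)] .
        also have "dist (an n) y \<le> dist (an n) a + (dist a (P p a) + dist (P p a) y)"
          by (metis add_left_mono dist_triangle order_trans)
        finally show ?case using elim y by (simp add: dist_commute)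
      qed
    qed
    show ?thesis
      unfolding x_def[symmetric]
    proof (rule ccontr)
      \<comment> \<open>A subsequence that stays away from the projection has a cluster point; it must be the projection.\<close>
      assume "\<not> x \<longlonglongrightarrow> P p a"
      then obtain e where e: "e > 0" and "\<not> eventually (\<lambda>n. dist (x n) (P p a) < e) sequentially"
        unfolding tendsto_iff by blast
      then have "\<exists>\<^sub>\<infinity>n. \<not> dist (x n) (P p a) < e"
        by (simp add: frequently_def cofinite_eq_sequentially)
      then have inf: "infinite {n. \<not> dist (x n) (P p a) < e}"
        by (simp add: frequently_cofinite)
      obtain r :: "nat \<Rightarrow> nat" where r: "strict_mono r" "\<And>n. \<not> dist (x (r n)) (P p a) < e"
        using infinite_enumerate[OF inf] by auto
      obtain N where N: "\<And>n. n \<ge> N \<Longrightarrow> dist a (x n) < dist a (P p a) + 1"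
        using near[of 1] by (auto simp: eventually_sequentially)
      define y where "y = (\<lambda>n. x (r (n + N)))"
      have rN: "strict_mono (\<lambda>n. r (n + N))" using r(1) by (simp add: strict_mono_def)
      have "\<forall>n. y n \<in> cball a (dist a (P p a) + 1)"
        using N seq_suble[OF r(1)] unfolding y_def
        by (metis le_add2 less_imp_le mem_cball order_trans)
      then obtain l s where ls: "strict_mono s" "(y \<circ> s) \<longlonglongrightarrow> l"
        using compact_cball[of a "dist a (P p a) + 1"] unfolding compact_def by metis
      define u where "u = (\<lambda>n. r (s n + N))"
      have u: "strict_mono u" unfolding u_def
        using strict_mono_o[OF rN ls(1)] by (simp add: comp_def)
      have xl: "(\<lambda>n. x (u n)) \<longlonglongrightarrow> l" using ls(2) by (simp add: y_def u_def comp_def)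
      have pu: "(\<lambda>n. pn (u n)) \<longlonglongrightarrow> p" using LIMSEQ_subseq_LIMSEQ[OF pn u] by (simp add: comp_def)
      have lK: "l \<in> K p"
        by (rule closed_graph[OF pD, of "\<lambda>n. pn (u n)" "\<lambda>n. x (u n)"])
          (use pnD PK pu xl in \<open>auto simp: x_def\<close>)
      have "dist a l \<le> dist a (P p a) + d" if "d > 0" for d
      proof (rule LIMSEQ_le_const2)
        show "(\<lambda>n. dist a (x (u n))) \<longlonglongrightarrow> dist a l" by (intro tendsto_intros xl)
        obtain M where M: "\<And>n. n \<ge> M \<Longrightarrow> dist a (x n) < dist a (P p a) + d"
          using near[OF \<open>d > 0\<close>] by (auto simp: eventually_sequentially)
        show "\<exists>M. \<forall>n\<ge>M. dist a (x (u n)) \<le> dist a (P p a) + d"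
          using M seq_suble[OF u] by (metis less_imp_le order_trans)
      qed
      then have "dist a l \<le> dist a (P p a)" by (rule field_le_epsilon)
      then have "\<forall>z\<in>K p. dist a l \<le> dist a z" using Ple[OF pD] order_trans by blast
      then have "l = P p a"
        unfolding P_def using closest_point_unique[OF convex[OF pD] closed[OF pD] lK] by blast
      moreover have "e \<le> dist l (P p a)"
      proof (rule LIMSEQ_le_const)
        show "(\<lambda>n. dist (x (u n)) (P p a)) \<longlonglongrightarrow> dist l (P p a)" by (intro tendsto_intros xl)
        show "\<exists>N. \<forall>n\<ge>N. e \<le> dist (x (u n)) (P p a)" using r(2) by (auto simp: u_def not_less)
      qed
      ultimately show False using e by simp
    qed
  qed
  show ?thesis
    unfolding continuous_on_sequentially
  proof (intro ballI allI impI, elim conjE)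
    fix xs z assume z: "z \<in> D \<times> UNIV" and D: "\<forall>n. xs n \<in> D \<times> (UNIV :: 'x set)" and lim: "xs \<longlonglongrightarrow> z"
    have "(\<lambda>n. P (fst (xs n)) (snd (xs n))) \<longlonglongrightarrow> P (fst z) (snd z)"
    proof (rule tends)
      show "fst z \<in> D" using z by auto
      show "fst (xs n) \<in> D" for n using D by (metis mem_Sigma_iff prod.collapse)
    qed (use lim in \<open>auto intro: tendsto_intros\<close>)
    then show "((\<lambda>(p, a). closest_point (K p) a) \<circ> xs) \<longlonglongrightarrow> (\<lambda>(p, a). closest_point (K p) a) z"
      by (simp add: P_def comp_def case_prod_unfold)
  qed
qed

section \<open>The joint feasible set as a second-order cone set\<close>

lemma hdot_lin:
  "hdot h (x + y) = hdot h x + hdot h y"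
  "hdot h (r *\<^sub>R x) = r *\<^sub>R hdot h x"
  "hdot h (c *s x) = c * hdot h x"
  by (simp_all add: hdot_def sum.distrib sum_distrib_left scaleR_sum_right algebra_simps)

lemma continuous_hdot [continuous_intros]:
  "continuous_on S f \<Longrightarrow> continuous_on S g \<Longrightarrow> continuous_on S (\<lambda>x. hdot (f x) (g x))"
  unfolding hdot_def by (intro continuous_intros)

text \<open>
  What the signal of user \<open>k\<close> has to beat at its own base station: the intra-cell interference, the
  held copies of the inter-cell amplitudes, and the noise, kept as one vector so that the SINR
  constraint becomes a bound on its norm. It is affine, not linear, because the noise entry is fixed.
\<close>

definition disturbance ::
  "('k::finite \<Rightarrow> 'b::finite) \<Rightarrow> ('k \<Rightarrow> real) \<Rightarrow> complex^'n^'k^'b \<Rightarrow> 'k \<Rightarrow>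
   complex^'n^'k \<Rightarrow> real^('b \<times> 'b \<times> 'k) \<Rightarrow> (complex^'k) \<times> (real^'b) \<times> real"
  where "disturbance bs \<sigma> H k W t =
    (\<chi> l. if bs l = bs k \<and> l \<noteq> k then hdot (H $ bs k $ k) (W $ l) else 0,
     \<chi> m. if m \<noteq> bs k then t $ (bs k, m, k) else 0,
     \<sigma> k)"

definition leakage ::
  "('k::finite \<Rightarrow> 'b::finite) \<Rightarrow> complex^'n^'k^'b \<Rightarrow> 'b \<Rightarrow> 'k \<Rightarrow> complex^'n^'k \<Rightarrow> complex^'k"
  where "leakage bs H m k W = (\<chi> l. if bs l = m then hdot (H $ m $ k) (W $ l) else 0)"

definition joint_feasible ::
  "('k::finite \<Rightarrow> 'b::finite) \<Rightarrow> ('k \<Rightarrow> real) \<Rightarrow> ('k \<Rightarrow> real) \<Rightarrow> complex^'n^'k^'b \<Rightarrow>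
   ((complex^'n^'k) \<times> (real^('b \<times> 'b \<times> 'k))) set"
  where "joint_feasible bs \<gamma> \<sigma> H =
    {(W, t). \<forall>b. local_feasible bs \<gamma> \<sigma> H b (W, block b t)}"

lemma sum_norm_sq_if:
  "(\<Sum>i\<in>(UNIV::'i::finite set). (norm (if P i then f i else 0))\<^sup>2) = (\<Sum>i | P i. (norm (f i))\<^sup>2)"
proof -
  have "(norm (if P i then f i else 0))\<^sup>2 = (if P i then (norm (f i))\<^sup>2 else 0)" for i by simp
  then show ?thesis by (simp add: sum.If_cases)
qed

lemma norm_sq_disturbance:
  "(norm (disturbance bs \<sigma> H k W t))\<^sup>2 =
     (\<Sum>l\<in>users bs (bs k) - {k}. (cmod (hdot (H $ bs k $ k) (W $ l)))\<^sup>2)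
     + (\<Sum>m\<in>UNIV - {bs k}. (t $ (bs k, m, k))\<^sup>2) + (\<sigma> k)\<^sup>2"
proof -
  have 1: "users bs (bs k) - {k} = {l. bs l = bs k \<and> l \<noteq> k}" by (auto simp: users_def)
  have 2: "UNIV - {bs k} = {m. m \<noteq> bs k}" by auto
  show ?thesis
    unfolding 1 2
    by (simp add: disturbance_def norm_Pair norm_vec_def L2_set_def sum_nonneg sum_norm_sq_if
        del: real_norm_def) simp
qed

lemma norm_leakage:
  "norm (leakage bs H m k W) = sqrt (\<Sum>l\<in>users bs m. (cmod (hdot (H $ m $ k) (W $ l)))\<^sup>2)"
  by (simp add: leakage_def norm_vec_def L2_set_def users_def sum_norm_sq_if)

text \<open>
  The square root of the SINR constraint is a cone constraint between an affine vector and
  \<open>hdot\<close>; the latter is its own modulus by the phase convention. The two kinds of copies separate: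
  \<open>t $ (bs k, m, k)\<close> enters only the SINR constraints and \<open>t $ (m, m, k)\<close> only the bounds on the
  leakage.
\<close>

lemma joint_feasible_iff:
  assumes "\<And>k. \<gamma> k > 0"
  shows "(W, t) \<in> joint_feasible bs \<gamma> \<sigma> H \<longleftrightarrow>
    t \<in> t_space bs \<and>
    (\<forall>k. hdot (H $ bs k $ k) (W $ k) \<in> \<real>\<^sub>\<ge>\<^sub>0) \<and>
    (\<forall>k. sqrt (\<gamma> k) * norm (disturbance bs \<sigma> H k W t) \<le> cmod (hdot (H $ bs k $ k) (W $ k))) \<and>
    (\<forall>m k. m \<noteq> bs k \<longrightarrow> norm (leakage bs H m k W) \<le> t $ (m, m, k))"
proof -
  have sq: "sqrt (\<gamma> k) * norm (disturbance bs \<sigma> H k W t) \<le> c \<longleftrightarrow>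
     \<gamma> k * (norm (disturbance bs \<sigma> H k W t))\<^sup>2 \<le> c\<^sup>2" if "c \<ge> 0" for k c
    using that assms[of k] abs_le_square_iff[of "sqrt (\<gamma> k) * norm (disturbance bs \<sigma> H k W t)" c]
    by (simp add: power_mult_distrib abs_mult)
  show ?thesis
    unfolding joint_feasible_def local_feasible_def
    by (auto simp: sq norm_sq_disturbance norm_leakage t_space_def block_def users_def)
qed

lemma disturbance_affine:
  "u + v = 1 \<Longrightarrow> disturbance bs \<sigma> H k (u *\<^sub>R W + v *\<^sub>R W') (u *\<^sub>R t + v *\<^sub>R t') =
    u *\<^sub>R disturbance bs \<sigma> H k W t + v *\<^sub>R disturbance bs \<sigma> H k W' t'"
  by (simp add: disturbance_def vec_eq_iff hdot_lin distrib_right[symmetric])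

lemma leakage_linear:
  "leakage bs H m k (u *\<^sub>R W + v *\<^sub>R W') = u *\<^sub>R leakage bs H m k W + v *\<^sub>R leakage bs H m k W'"
  by (simp add: leakage_def vec_eq_iff hdot_lin)

lemma norm_convex_combination_le:
  fixes a b :: "'x::real_normed_vector"
  assumes "0 \<le> u" "0 \<le> v" "u + v = 1" "norm a \<le> r" "norm b \<le> s"
  shows "norm (u *\<^sub>R a + v *\<^sub>R b) \<le> u * r + v * s"
  using assms by (intro order.trans[OF norm_triangle_ineq] add_mono) (auto intro: mult_left_mono)

text \<open>
  Norms of affine maps are convex, and on the nonnegative reals the modulus on the right-hand side
  is linear. The phase convention is essential: without it the beam-formers \<open>W\<close> and \<open>- W\<close> would both
  be feasible, but not their midpoint \<open>0\<close>.
\<close>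

lemma convex_joint_feasible:
  assumes \<gamma>: "\<And>k. \<gamma> k > 0"
  shows "convex (joint_feasible bs \<gamma> \<sigma> H)"
proof (rule convexI)
  fix x y u v
  assume x: "x \<in> joint_feasible bs \<gamma> \<sigma> H" and y: "y \<in> joint_feasible bs \<gamma> \<sigma> H"
    and uv: "0 \<le> (u::real)" "0 \<le> v" "u + v = 1"
  obtain W t W' t' where xy: "x = (W, t)" "y = (W', t')" by (metis prod.exhaust)
  note X = x[unfolded xy joint_feasible_iff[OF \<gamma>]] and Y = y[unfolded xy joint_feasible_iff[OF \<gamma>]]
  note ccomb = norm_convex_combination_le[OF uv]
  show "u *\<^sub>R x + v *\<^sub>R y \<in> joint_feasible bs \<gamma> \<sigma> H"
    unfolding xy scaleR_Pair add_Pair joint_feasible_iff[OF \<gamma>]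
  proof (intro conjI allI impI)
    show "u *\<^sub>R t + v *\<^sub>R t' \<in> t_space bs" using X Y by (simp add: t_space_def)
    fix k
    let ?d = "\<lambda>W. hdot (H $ bs k $ k) (W $ k)"
    have nn: "?d W \<in> \<real>\<^sub>\<ge>\<^sub>0" "?d W' \<in> \<real>\<^sub>\<ge>\<^sub>0" using X Y by auto
    have comb: "?d (u *\<^sub>R W + v *\<^sub>R W') = u *\<^sub>R ?d W + v *\<^sub>R ?d W'" by (simp add: hdot_lin)
    show nn': "?d (u *\<^sub>R W + v *\<^sub>R W') \<in> \<real>\<^sub>\<ge>\<^sub>0"
      unfolding comb using nn uv by (auto simp: complex_nonneg_Reals_iff)
    have cmod_eq: "cmod z = Re z" if "z \<in> \<real>\<^sub>\<ge>\<^sub>0" for z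
      using that by (metis complex_nonneg_Reals_iff cmod_eq_Re abs_of_nonneg)
    have "norm (disturbance bs \<sigma> H k W t) \<le> cmod (?d W) / sqrt (\<gamma> k)"
      "norm (disturbance bs \<sigma> H k W' t') \<le> cmod (?d W') / sqrt (\<gamma> k)"
      using X Y \<gamma>[of k] by (simp_all add: field_simps)
    from ccomb[OF this] show "sqrt (\<gamma> k) * norm (disturbance bs \<sigma> H k (u *\<^sub>R W + v *\<^sub>R W') (u *\<^sub>R t + v *\<^sub>R t'))
        \<le> cmod (?d (u *\<^sub>R W + v *\<^sub>R W'))"
      using \<gamma>[of k] unfolding disturbance_affine[OF uv(3)] cmod_eq[OF nn'] cmod_eq[OF nn(1)] cmod_eq[OF nn(2)]
      by (simp add: hdot_lin field_simps)
    fix m assume "m \<noteq> bs k"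
    then show "norm (leakage bs H m k (u *\<^sub>R W + v *\<^sub>R W')) \<le> (u *\<^sub>R t + v *\<^sub>R t') $ (m, m, k)"
      unfolding leakage_linear using X Y by (simp add: ccomb)
  qed
qed

lemma continuous_disturbance [continuous_intros]:
  assumes "continuous_on S fH" "continuous_on S fW" "continuous_on S ft"
  shows "continuous_on S (\<lambda>x. disturbance bs \<sigma> (fH x) k (fW x) (ft x))"
proof -
  have "continuous_on S (\<lambda>x. if bs l = bs k \<and> l \<noteq> k then hdot (fH x $ bs k $ k) (fW x $ l) else 0)" for l
    using assms by (cases "bs l = bs k \<and> l \<noteq> k") (auto intro!: continuous_intros)
  moreover have "continuous_on S (\<lambda>x. if m \<noteq> bs k then ft x $ (bs k, m, k) else 0)" for m
    using assms by (cases "m \<noteq> bs k") (auto intro!: continuous_intros)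
  ultimately show ?thesis
    unfolding disturbance_def by (intro continuous_intros continuous_on_vec_lambda)
qed

lemma continuous_leakage [continuous_intros]:
  assumes "continuous_on S fH" "continuous_on S fW"
  shows "continuous_on S (\<lambda>x. leakage bs (fH x) m k (fW x))"
proof -
  have "continuous_on S (\<lambda>x. if bs l = m then hdot (fH x $ m $ k) (fW x $ l) else 0)" for l
    using assms by (cases "bs l = m") (auto intro!: continuous_intros)
  then show ?thesis
    unfolding leakage_def by (intro continuous_intros continuous_on_vec_lambda)
qed

lemma closed_t_space: "closed (t_space bs)"
  unfolding t_space_def by (intro closed_Collect_all closed_Collect_imp closed_Collect_eq open_Collect_const continuous_intros)

lemma closed_joint_feasible_graph:
  fixes bs :: "'k::finite \<Rightarrow> 'b::finite"
  assumes \<gamma>: "\<And>k. \<gamma> k > 0"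
  shows "closed {(H :: complex^'n::finite^'k^'b, x). x \<in> joint_feasible bs \<gamma> \<sigma> H}"
proof -
  have 1: "closed ((\<lambda>z :: (complex^'n^'k^'b) \<times> (complex^'n^'k) \<times> _. snd (snd z)) -` t_space bs)"
    by (intro closed_vimage closed_t_space continuous_intros)
  have 2: "closed ((\<lambda>z :: (complex^'n^'k^'b) \<times> (complex^'n^'k) \<times> (real^('b\<times>'b\<times>'k)). hdot (fst z $ bs k $ k) (fst (snd z) $ k)) -` \<real>\<^sub>\<ge>\<^sub>0)" for k
    by (intro closed_vimage closed_nonneg_Reals_complex continuous_intros)
  have eq: "{(H :: complex^'n::finite^'k^'b, x). x \<in> joint_feasible bs \<gamma> \<sigma> H} =
     {z. snd (snd z) \<in> t_space bs \<and> (\<forall>k. hdot (fst z $ bs k $ k) (fst (snd z) $ k) \<in> \<real>\<^sub>\<ge>\<^sub>0) \<and>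
     (\<forall>k. sqrt (\<gamma> k) * norm (disturbance bs \<sigma> (fst z) k (fst (snd z)) (snd (snd z))) \<le> cmod (hdot (fst z $ bs k $ k) (fst (snd z) $ k))) \<and>
    (\<forall>m k. m \<noteq> bs k \<longrightarrow> norm (leakage bs (fst z) m k (fst (snd z))) \<le> snd (snd z) $ (m, m, k))}"
    by (simp add: set_eq_iff joint_feasible_iff[where \<gamma> = \<gamma>, OF \<gamma>])
  show ?thesis unfolding eq
    using 1 2 by (intro closed_Collect_conj closed_Collect_all closed_Collect_imp closed_Collect_le open_Collect_const continuous_intros)
      (auto simp: vimage_def)
qed

section \<open>Phase alignment and nonemptiness\<close>

lemma norm_disturbance_pos:
  assumes "(\<sigma> k)\<^sup>2 > 0"
  shows "norm (disturbance bs \<sigma> H k W t) > 0"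
proof -
  have "(norm (disturbance bs \<sigma> H k W t))\<^sup>2 > 0"
    unfolding norm_sq_disturbance using assms by (intro add_nonneg_pos add_nonneg_nonneg sum_nonneg) auto
  then show ?thesis by auto
qed

text \<open>
  Multiplies each beam-former by the phase that restores the phase convention for the channel \<open>H\<close>.
\<close>

definition align ::
  "('k::finite \<Rightarrow> 'b::finite) \<Rightarrow> complex^'n^'k^'b \<Rightarrow> complex^'n^'k \<Rightarrow> complex^'n^'k"
  where "align bs H W = (\<chi> k. cnj (sgn (hdot (H $ bs k $ k) (W $ k))) *s W $ k)"

text \<open>
  All constraints other than the phase convention involve only moduli, which a change of phase
  preserves. The SINR constraint forces a nonzero desired signal, since there is noise, so the
  phase is well defined.
\<close>

lemma align_feasible:
  fixes bs :: "'k::finite \<Rightarrow> 'b::finite"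
  assumes \<gamma>: "\<And>k. \<gamma> k > 0" and \<sigma>: "\<And>k. (\<sigma> k)\<^sup>2 > 0"
    and t: "t \<in> t_space bs"
    and sinr: "\<And>k. sqrt (\<gamma> k) * norm (disturbance bs \<sigma> H k W t) \<le> cmod (hdot (H $ bs k $ k) (W $ k))"
    and int: "\<And>m k. m \<noteq> bs k \<Longrightarrow> norm (leakage bs H m k W) \<le> t $ (m, m, k)"
  shows "(align bs H W, t) \<in> joint_feasible bs \<gamma> \<sigma> H"
proof -
  have nz: "hdot (H $ bs k $ k) (W $ k) \<noteq> 0" for k
  proof -
    have "0 < sqrt (\<gamma> k) * norm (disturbance bs \<sigma> H k W t)"
      using \<gamma>[of k] by (intro mult_pos_pos norm_disturbance_pos \<sigma>) simp
    with sinr[of k] show ?thesis by auto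
  qed
  have cm: "cmod (hdot h (align bs H W $ l)) = cmod (hdot h (W $ l))" for h l
    using nz[of l] by (simp add: align_def hdot_lin norm_mult norm_sgn)
  have own: "hdot (H $ bs k $ k) (align bs H W $ k) = of_real (cmod (hdot (H $ bs k $ k) (W $ k)))" for k
    using nz[of k]
    by (simp add: align_def hdot_lin sgn_eq complex_norm_square[symmetric] power2_eq_square field_simps)
  have "norm (disturbance bs \<sigma> H k (align bs H W) t) = norm (disturbance bs \<sigma> H k W t)" for k
    by (rule power2_eq_imp_eq) (simp_all add: norm_sq_disturbance cm)
  moreover have "norm (leakage bs H m k (align bs H W)) = norm (leakage bs H m k W)" for m k
    by (simp add: norm_leakage cm)
  ultimately show ?thesis
    unfolding joint_feasible_iff[where \<gamma> = \<gamma>, OF \<gamma>] using t sinr int by (simp add: cm own)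
qed

lemma align_eq_self:
  assumes "\<And>k. hdot (H $ bs k $ k) (W $ k) \<in> \<real>\<^sub>\<ge>\<^sub>0" "\<And>k. hdot (H $ bs k $ k) (W $ k) \<noteq> 0"
  shows "align bs H W = W"
proof -
  have "sgn (hdot (H $ bs k $ k) (W $ k)) = 1" for k
    using assms(1)[of k] assms(2)[of k] by (auto elim!: nonneg_Reals_cases simp: sgn_of_real)
  then show ?thesis by (simp add: align_def)
qed

lemma isCont_align:
  assumes "\<And>k. hdot (H $ bs k $ k) (W $ k) \<noteq> 0"
  shows "isCont (\<lambda>H. align bs H W) H"
proof -
  have "((\<lambda>H. hdot (H $ bs k $ k) (W $ k)) \<longlongrightarrow> hdot (H $ bs k $ k) (W $ k)) (at H)" for k
    unfolding hdot_def by (intro tendsto_intros)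
  then show ?thesis
    unfolding isCont_def align_def vector_scalar_mult_def using assms
    by (intro tendsto_vec_lambda tendsto_intros) auto
qed

text \<open>
  The copies are set to the interference amplitudes that the beam-formers really cause; the local
  SINR constraints are then the global ones.
\<close>

lemma joint_feasible_nonempty:
  fixes bs :: "'k::finite \<Rightarrow> 'b::finite"
  assumes \<gamma>: "\<And>k. \<gamma> k > 0" and \<sigma>: "\<And>k. (\<sigma> k)\<^sup>2 > 0"
    and "strictly_feasible bs \<gamma> \<sigma> H"
  shows "joint_feasible bs \<gamma> \<sigma> H \<noteq> {}"
proof -
  obtain W where W: "\<And>k. SINR bs \<sigma> k W H > \<gamma> k"
    using assms(3) unfolding strictly_feasible_def by auto
  define t where "t = (\<chi> q. if q \<in> copies bs then case q of (c, m, k) \<Rightarrow> norm (leakage bs H m k W) else 0)"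
  have "(align bs H W, t) \<in> joint_feasible bs \<gamma> \<sigma> H"
  proof (rule align_feasible[OF \<gamma> \<sigma>])
    show "t \<in> t_space bs" by (simp add: t_space_def t_def)
    show "norm (leakage bs H m k W) \<le> t $ (m, m, k)" if "m \<noteq> bs k" for m k
      using that by (simp add: t_def copies_def)
    fix k
    have t: "(\<Sum>i\<in>users bs m. (cmod (hdot (H $ m $ k) (W $ i)))\<^sup>2) = (t $ (bs k, m, k))\<^sup>2" if "m \<in> UNIV - {bs k}" for m
      using that by (simp add: t_def copies_def norm_leakage sum_nonneg)
    have "SINR bs \<sigma> k W H =
        (cmod (hdot (H $ bs k $ k) (W $ k)))\<^sup>2 / (norm (disturbance bs \<sigma> H k W t))\<^sup>2"
      unfolding SINR_def norm_sq_disturbance by (simp only: sum.cong[OF refl t])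
    then have "\<gamma> k * (norm (disturbance bs \<sigma> H k W t))\<^sup>2 \<le> (cmod (hdot (H $ bs k $ k) (W $ k)))\<^sup>2"
      using W[of k] norm_disturbance_pos[where \<sigma> = \<sigma>, OF \<sigma>, of bs H k W t] by (simp add: field_simps)
    then have "(sqrt (\<gamma> k) * norm (disturbance bs \<sigma> H k W t))\<^sup>2 \<le> (cmod (hdot (H $ bs k $ k) (W $ k)))\<^sup>2"
      using \<gamma>[of k] by (simp add: power_mult_distrib)
    then show "sqrt (\<gamma> k) * norm (disturbance bs \<sigma> H k W t) \<le> cmod (hdot (H $ bs k $ k) (W $ k))"
      by (rule power2_le_imp_le) simp
  qed
  then show ?thesis by blast
qed

section \<open>Lower hemicontinuity of the feasible set\<close>

text \<open>
  The direction that loosens the leakage bounds: it raises only the copies held by the interfering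
  base station, which no SINR constraint sees.
\<close>

definition leak_slack :: "('k::finite \<Rightarrow> 'b::finite) \<Rightarrow> real^('b \<times> 'b \<times> 'k)"
  where "leak_slack bs = (\<chi> q. case q of (c, m, k) \<Rightarrow> if c = m \<and> m \<noteq> bs k then 1 else 0)"

lemma leak_slack_nth [simp]: "leak_slack bs $ (c, m, k) = (if c = m \<and> m \<noteq> bs k then 1 else 0)"
  by (simp add: leak_slack_def)

text \<open>
  Scaling a feasible point up by \<open>1 + d\<close> multiplies the signal and all interference but not the
  noise, so that every SINR constraint becomes strict; the slack makes the leakage bounds strict.
\<close>

lemma joint_feasible_perturb:
  fixes bs :: "'k::finite \<Rightarrow> 'b::finite" and H :: "complex^'n::finite^'k^'b"
  assumes \<gamma>: "\<And>k. \<gamma> k > 0" and \<sigma>: "\<And>k. (\<sigma> k)\<^sup>2 > 0"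
    and feas: "(W, t) \<in> joint_feasible bs \<gamma> \<sigma> H" and d: "d > 0"
  defines "W' \<equiv> (1 + d) *\<^sub>R W"
    and "t' \<equiv> (1 + d) *\<^sub>R t + d *\<^sub>R leak_slack bs"
  shows "t' \<in> t_space bs"
    and "hdot (H $ bs k $ k) (W' $ k) \<in> \<real>\<^sub>\<ge>\<^sub>0"
    and "sqrt (\<gamma> k) * norm (disturbance bs \<sigma> H k W' t') < cmod (hdot (H $ bs k $ k) (W' $ k))"
    and "m \<noteq> bs k \<Longrightarrow> norm (leakage bs H m k W') < t' $ (m, m, k)"
proof -
  note F = feas[unfolded joint_feasible_iff[where \<gamma> = \<gamma>, OF \<gamma>]]
  have h: "hdot x (W' $ k) = (1 + d) *\<^sub>R hdot x (W $ k)" for x k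
    by (simp only: W'_def hdot_lin vector_scaleR_component)
  show "t' \<in> t_space bs" using F by (auto simp: t_space_def t'_def copies_def)
  show "hdot (H $ bs k $ k) (W' $ k) \<in> \<real>\<^sub>\<ge>\<^sub>0"
    using F d unfolding h by (simp add: complex_nonneg_Reals_iff)
  have cm: "(cmod (hdot x (W' $ k)))\<^sup>2 = (1 + d)\<^sup>2 * (cmod (hdot x (W $ k)))\<^sup>2" for x k
    unfolding h using d by (simp add: power_mult_distrib del: scaleR_left.add scaleR_add_left)
  have t: "(\<Sum>m\<in>UNIV - {bs k}. (t' $ (bs k, m, k))\<^sup>2) =
      (1 + d)\<^sup>2 * (\<Sum>m\<in>UNIV - {bs k}. (t $ (bs k, m, k))\<^sup>2)" for k
    unfolding sum_distrib_left by (intro sum.cong) (auto simp: t'_def power_mult_distrib)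
  have "(norm (disturbance bs \<sigma> H k W' t'))\<^sup>2 < ((1 + d) * norm (disturbance bs \<sigma> H k W t))\<^sup>2"
  proof -
    have "1 < (1 + d)\<^sup>2" using d by (simp add: power2_eq_square algebra_simps add_pos_pos)
    then have "1 * (\<sigma> k)\<^sup>2 < (1 + d)\<^sup>2 * (\<sigma> k)\<^sup>2" using \<sigma>[of k] by (intro mult_strict_right_mono)
    then show ?thesis
      unfolding power_mult_distrib norm_sq_disturbance cm t
      by (simp add: distrib_left sum_distrib_left)
  qed
  then have "norm (disturbance bs \<sigma> H k W' t') < (1 + d) * norm (disturbance bs \<sigma> H k W t)"
    by (rule power2_less_imp_less) (use d in auto)
  then have "sqrt (\<gamma> k) * norm (disturbance bs \<sigma> H k W' t')
      < sqrt (\<gamma> k) * ((1 + d) * norm (disturbance bs \<sigma> H k W t))"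
    using \<gamma>[of k] by simp
  also have "\<dots> = (1 + d) * (sqrt (\<gamma> k) * norm (disturbance bs \<sigma> H k W t))" by simp
  also have "\<dots> \<le> (1 + d) * cmod (hdot (H $ bs k $ k) (W $ k))"
    using F d by (intro mult_left_mono) auto
  also have "\<dots> = cmod (hdot (H $ bs k $ k) (W' $ k))"
    unfolding h using d by (simp del: scaleR_left.add scaleR_add_left)
  finally show "sqrt (\<gamma> k) * norm (disturbance bs \<sigma> H k W' t') < cmod (hdot (H $ bs k $ k) (W' $ k))" .
  assume m: "m \<noteq> bs k"
  have "leakage bs H m k W' = (1 + d) *\<^sub>R leakage bs H m k W"
    by (simp add: leakage_def vec_eq_iff h del: scaleR_left.add scaleR_add_left)
  then have "norm (leakage bs H m k W') = (1 + d) * norm (leakage bs H m k W)" using d by simp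
  also have "\<dots> \<le> (1 + d) * t $ (m, m, k)" using F m d by (intro mult_left_mono) auto
  also have "\<dots> < t' $ (m, m, k)" using m d by (simp add: t'_def)
  finally show "norm (leakage bs H m k W') < t' $ (m, m, k)" .
qed

text \<open>
  Close to the given feasible point lies a strictly feasible one. Its strict inequalities survive
  small changes of the channel. The phase convention does not, but realigning the phases repairs it
  and moves the point only slightly, since alignment is continuous in the channel and leaves the
  point fixed at \<open>H\<close>.
\<close>

lemma joint_feasible_lower_hemicontinuous:
  fixes bs :: "'k::finite \<Rightarrow> 'b::finite" and H :: "complex^'n::finite^'k^'b"
  assumes \<gamma>: "\<And>k. \<gamma> k > 0" and \<sigma>: "\<And>k. (\<sigma> k)\<^sup>2 > 0"
    and x: "x \<in> joint_feasible bs \<gamma> \<sigma> H" and e: "e > 0"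
  shows "eventually (\<lambda>H'. \<exists>y\<in>joint_feasible bs \<gamma> \<sigma> H'. dist y x < e) (nhds H)"
proof -
  obtain W t where xWt: "x = (W, t)" by (cases x)
  have "((\<lambda>d. ((1 + d) *\<^sub>R W, (1 + d) *\<^sub>R t + d *\<^sub>R leak_slack bs))
      \<longlongrightarrow> ((1 + 0) *\<^sub>R W, (1 + 0) *\<^sub>R t + 0 *\<^sub>R leak_slack bs)) (at_right 0)"
    by (intro tendsto_intros)
  then have "eventually (\<lambda>d. dist ((1 + d) *\<^sub>R W, (1 + d) *\<^sub>R t + d *\<^sub>R leak_slack bs) x < e/2) (at_right 0)"
    using e unfolding xWt by (intro tendstoD) auto
  moreover have "eventually (\<lambda>d::real. d > 0) (at_right 0)" by (rule eventually_at_right_less)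
  ultimately have "eventually (\<lambda>d. d > 0 \<and>
      dist ((1 + d) *\<^sub>R W, (1 + d) *\<^sub>R t + d *\<^sub>R leak_slack bs) x < e/2) (at_right 0)"
    by eventually_elim auto
  then obtain d where d: "d > 0"
    and dd: "dist ((1 + d) *\<^sub>R W, (1 + d) *\<^sub>R t + d *\<^sub>R leak_slack bs) x < e/2"
    using eventually_happens'[OF trivial_limit_at_right_real] by blast
  define Wd where "Wd = (1 + d) *\<^sub>R W"
  define td where "td = (1 + d) *\<^sub>R t + d *\<^sub>R leak_slack bs"
  note S = joint_feasible_perturb[OF \<gamma> \<sigma> x[unfolded xWt] d, folded Wd_def td_def]
  note dd = dd[folded Wd_def td_def]
  have nz: "hdot (H $ bs k $ k) (Wd $ k) \<noteq> 0" for k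
  proof -
    have "0 \<le> sqrt (\<gamma> k) * norm (disturbance bs \<sigma> H k Wd td)" using \<gamma>[of k] by simp
    with S(3)[of k] show ?thesis by auto
  qed
  have "((\<lambda>H. align bs H Wd) \<longlongrightarrow> align bs H Wd) (nhds H)"
    using isCont_align[OF nz] unfolding isCont_def
    tendsto_at_iff_tendsto_nhds[of "\<lambda>H. align bs H Wd"] .
  then have 1: "eventually (\<lambda>H'. dist (align bs H' Wd) Wd < e/2) (nhds H)"
    using e unfolding align_eq_self[of H bs, OF S(2) nz] by (intro tendstoD) auto
  have 2: "eventually (\<lambda>H'. \<forall>k. sqrt (\<gamma> k) * norm (disturbance bs \<sigma> H' k Wd td) < cmod (hdot (H' $ bs k $ k) (Wd $ k))) (nhds H)"
  proof (rule eventually_all_finite)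
    fix k
    have "open {H'. sqrt (\<gamma> k) * norm (disturbance bs \<sigma> H' k Wd td) < cmod (hdot (H' $ bs k $ k) (Wd $ k))}"
      by (intro open_Collect_less continuous_intros)
    from eventually_nhds_in_open[OF this, of H] S(3)
    show "eventually (\<lambda>H'. sqrt (\<gamma> k) * norm (disturbance bs \<sigma> H' k Wd td) < cmod (hdot (H' $ bs k $ k) (Wd $ k))) (nhds H)"
      by simp
  qed
  have 3: "eventually (\<lambda>H'. \<forall>m k. m \<noteq> bs k \<longrightarrow> norm (leakage bs H' m k Wd) < td $ (m, m, k)) (nhds H)"
  proof (intro eventually_all_finite)
    fix m k
    have "open {H'. norm (leakage bs H' m k Wd) < td $ (m, m, k)}"
      by (intro open_Collect_less continuous_intros)
    from eventually_nhds_in_open[OF this, of H] S(4)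
    show "eventually (\<lambda>H'. m \<noteq> bs k \<longrightarrow> norm (leakage bs H' m k Wd) < td $ (m, m, k)) (nhds H)"
      by (cases "m = bs k") simp_all
  qed
  show ?thesis
    using 1 2 3
  proof eventually_elim
    case (elim H')
    have "(align bs H' Wd, td) \<in> joint_feasible bs \<gamma> \<sigma> H'"
      by (rule align_feasible[OF \<gamma> \<sigma> S(1)]) (use elim in \<open>auto intro: less_imp_le\<close>)
    moreover have "dist (align bs H' Wd, td) x
        \<le> dist (align bs H' Wd, td) (Wd, td) + dist (Wd, td) x"
      by (rule dist_triangle)
    then have "dist (align bs H' Wd, td) x < e"
      using elim(1) dd by (simp add: dist_Pair_Pair)
    ultimately show ?case by blast
  qed
qed

section \<open>The local problems as one projection\<close>

lemma block_copy_mult: "block b A *v \<tau> = block b (A *v \<tau>)"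
  by (simp add: block_def matrix_vector_mult_def vec_eq_iff)

lemma sum_inner_block: "(\<Sum>b\<in>UNIV. block b x \<bullet> block b y) = x \<bullet> y"
  by (simp add: block_def inner_vec_def sum.cartesian_product)

lemma block_diff: "block b x - block b y = block b (x - y)"
  by (simp add: block_def vec_eq_iff)

lemma sum_local_cost:
  fixes bs :: "'k::finite \<Rightarrow> 'b::finite"
  shows
  "(\<Sum>b\<in>UNIV. local_cost bs \<rho> \<tau> \<nu> b (W, block b t)) =
    (norm W)\<^sup>2 + \<nu> \<bullet> (t - copy_matrix bs *v \<tau>) + \<rho> / 2 * (norm (t - copy_matrix bs *v \<tau>))\<^sup>2"
proof -
  have "(\<Sum>b\<in>UNIV. \<Sum>j\<in>users bs b. (norm (W $ j))\<^sup>2) = (\<Sum>j\<in>UNIV. (norm (W $ j))\<^sup>2)"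
    unfolding users_def using sum.group[of UNIV UNIV bs "\<lambda>j. (norm (W $ j))\<^sup>2"] by simp
  also have "\<dots> = (norm W)\<^sup>2" by (simp add: norm_vec_def L2_set_def sum_nonneg)
  finally have W: "(\<Sum>b\<in>UNIV. \<Sum>j\<in>users bs b. (norm (W $ j))\<^sup>2) = (norm W)\<^sup>2" .
  have "(\<Sum>b\<in>UNIV. \<rho> / 2 * (norm (block b x))\<^sup>2) = \<rho> / 2 * (norm x)\<^sup>2"
    for x :: "real^('b \<times> 'b \<times> 'k)"
    unfolding sum_distrib_left[symmetric] by (simp only: power2_norm_eq_inner sum_inner_block)
  with W show ?thesis
    by (simp add: local_cost_def sum.distrib block_copy_mult block_diff sum_inner_block)
qed

text \<open>
  The base stations share neither beam-formers nor copies, so both the feasible set and the cost are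
  separable.
\<close>

lemma local_minimizers_iff_joint_minimizer:
  fixes bs :: "'k::finite \<Rightarrow> 'b::finite"
  defines "C \<equiv> \<lambda>\<rho> \<tau> \<nu> (W, t). \<Sum>b\<in>UNIV. local_cost bs \<rho> \<tau> \<nu> b (W, block b t)"
  shows "(\<forall>b. is_arg_min (local_cost bs \<rho> \<tau> \<nu> b) (local_feasible bs \<gamma> \<sigma> H b) (W, block b t)) \<longleftrightarrow>
    (W, t) \<in> joint_feasible bs \<gamma> \<sigma> H \<and>
    (\<forall>y\<in>joint_feasible bs \<gamma> \<sigma> H. C \<rho> \<tau> \<nu> (W, t) \<le> C \<rho> \<tau> \<nu> y)"
    (is "?L \<longleftrightarrow> ?R")
proof
  assume L: ?L
  show ?R
  proof (intro conjI ballI)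
    show "(W, t) \<in> joint_feasible bs \<gamma> \<sigma> H" using L by (simp add: joint_feasible_def is_arg_min_def)
    fix y assume "y \<in> joint_feasible bs \<gamma> \<sigma> H"
    with L show "C \<rho> \<tau> \<nu> (W, t) \<le> C \<rho> \<tau> \<nu> y"
      by (cases y) (auto simp: C_def joint_feasible_def is_arg_min_def not_less intro!: sum_mono)
  qed
next
  assume R: ?R
  then have feas: "\<And>b. local_feasible bs \<gamma> \<sigma> H b (W, block b t)" by (simp add: joint_feasible_def)
  show ?L
  proof (intro allI)
    fix b
    have "local_cost bs \<rho> \<tau> \<nu> b (W, block b t) \<le> local_cost bs \<rho> \<tau> \<nu> b (W', t')"
      if y: "local_feasible bs \<gamma> \<sigma> H b (W', t')" for W' t'
    proof -
      \<comment> \<open>A better point for base station \<open>b\<close> alone is spliced into the joint minimizer.\<close>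
      define W2 where "W2 = (\<chi> k. if bs k = b then W' $ k else W $ k)"
      define t2 where "t2 = (\<chi> q. if fst q = b then t' $ snd q else t $ q)"
      have b2: "block c t2 = (if c = b then t' else block c t)" for c
        by (auto simp: block_def t2_def vec_eq_iff)
      have W2: "W2 $ k = (if bs k = b then W' $ k else W $ k)" for k by (simp add: W2_def)
      have f2: "local_feasible bs \<gamma> \<sigma> H c (W2, block c t2)" for c
        using feas[of c] y unfolding local_feasible_def b2 by (auto simp: W2 users_def)
      have c2: "local_cost bs \<rho> \<tau> \<nu> c (W2, block c t2) =
          (if c = b then local_cost bs \<rho> \<tau> \<nu> b (W', t') else local_cost bs \<rho> \<tau> \<nu> c (W, block c t))" for c
        unfolding local_cost_def b2 by (auto simp: W2 users_def)
      have "(W2, t2) \<in> joint_feasible bs \<gamma> \<sigma> H" using f2 by (simp add: joint_feasible_def)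
      then have "C \<rho> \<tau> \<nu> (W, t) \<le> C \<rho> \<tau> \<nu> (W2, t2)" using R by blast
      then show ?thesis
        by (simp add: C_def c2 sum.remove[of UNIV b])
    qed
    then show "is_arg_min (local_cost bs \<rho> \<tau> \<nu> b) (local_feasible bs \<gamma> \<sigma> H b) (W, block b t)"
      using feas by (auto simp: is_arg_min_def not_less)
  qed
qed

text \<open>
  The cost weighs the copies by \<open>\<rho> / 2\<close> and the beam-formers by \<open>1\<close>; stretching the copies by
  \<open>sqrt (\<rho> / 2)\<close> turns it into a squared Euclidean distance.
\<close>

definition stretch :: "real \<Rightarrow> 'a \<times> 'c::real_vector \<Rightarrow> 'a \<times> 'c"
  where "stretch s = (\<lambda>(W, t). (W, s *\<^sub>R t))"

text \<open>
  Completing the square moves the linear term in \<open>\<nu>\<close> into the point from which the distance is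
  measured.
\<close>

lemma joint_cost_eq_dist:
  fixes bs :: "'k::finite \<Rightarrow> 'b::finite"
  assumes "\<rho> > 0"
  shows "(\<Sum>b\<in>UNIV. local_cost bs \<rho> \<tau> \<nu> b (W, block b t)) =
    (dist (stretch (sqrt (\<rho> / 2)) (0, copy_matrix bs *v \<tau> - \<nu> /\<^sub>R \<rho>)) (stretch (sqrt (\<rho> / 2)) (W, t)))\<^sup>2
     - (norm \<nu>)\<^sup>2 / (2 * \<rho>)"
proof -
  define r where "r = t - copy_matrix bs *v \<tau>"
  have diff: "copy_matrix bs *v \<tau> - \<nu> /\<^sub>R \<rho> - t = - (r + \<nu> /\<^sub>R \<rho>)" by (simp add: r_def)
  have dist: "(dist (stretch u (0, c)) (stretch u (W, t)))\<^sup>2 = (norm W)\<^sup>2 + u\<^sup>2 * (norm (c - t))\<^sup>2" for c u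
  proof -
    have "dist (u *\<^sub>R c) (u *\<^sub>R t) = \<bar>u\<bar> * norm (c - t)"
      by (metis dist_norm norm_scaleR scaleR_diff_right)
    then show ?thesis by (simp add: stretch_def dist_Pair_Pair power_mult_distrib)
  qed
  have "(dist (stretch (sqrt (\<rho> / 2)) (0, copy_matrix bs *v \<tau> - \<nu> /\<^sub>R \<rho>)) (stretch (sqrt (\<rho> / 2)) (W, t)))\<^sup>2
     = (norm W)\<^sup>2 + \<rho> / 2 * (norm (r + \<nu> /\<^sub>R \<rho>))\<^sup>2"
    unfolding dist diff norm_minus_cancel using assms by simp
  also have "\<rho> / 2 * (norm (r + \<nu> /\<^sub>R \<rho>))\<^sup>2 = \<nu> \<bullet> r + \<rho> / 2 * (norm r)\<^sup>2 + (norm \<nu>)\<^sup>2 / (2 * \<rho>)"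
    using assms by (simp add: power2_norm_eq_inner inner_add_left inner_add_right inner_commute field_simps)
  finally show ?thesis unfolding sum_local_cost r_def by simp
qed

lemma linear_stretch: "linear (stretch s)"
  by (rule linearI) (auto simp: stretch_def scaleR_add_right)

lemma stretch_inverse: "s \<noteq> 0 \<Longrightarrow> stretch s (stretch (1 / s) x) = x" "s \<noteq> 0 \<Longrightarrow> stretch (1 / s) (stretch s x) = x"
  by (auto simp: stretch_def split: prod.split)


lemma inj_stretch: "s \<noteq> 0 \<Longrightarrow> inj (stretch s)"
  by (metis injI stretch_inverse(2))

definition scaled_feasible ::
  "('k::finite \<Rightarrow> 'b::finite) \<Rightarrow> ('k \<Rightarrow> real) \<Rightarrow> ('k \<Rightarrow> real) \<Rightarrow> real \<Rightarrow> complex^'n^'k^'b \<Rightarrow>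
   ((complex^'n^'k) \<times> (real^('b \<times> 'b \<times> 'k))) set"
  where "scaled_feasible bs \<gamma> \<sigma> s H = stretch s ` joint_feasible bs \<gamma> \<sigma> H"
lemma convex_scaled_feasible:
  assumes "\<And>k. \<gamma> k > 0"
  shows "convex (scaled_feasible bs \<gamma> \<sigma> s H)"
  unfolding scaled_feasible_def
  by (intro convex_linear_image linear_stretch convex_joint_feasible assms)


section \<open>Continuity of the iteration\<close>

lemma continuous_projection_onto_scaled_feasible:
  fixes bs :: "'k::finite \<Rightarrow> 'b::finite"
    and \<H> :: "(complex^'n::finite^'k^'b) set"
  assumes \<gamma>: "\<And>k. \<gamma> k > 0" and \<sigma>: "\<And>k. (\<sigma> k)\<^sup>2 > 0"
    and sf: "\<And>H. H \<in> \<H> \<Longrightarrow> strictly_feasible bs \<gamma> \<sigma> H"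
    and s: "s \<noteq> 0"
  shows "continuous_on (\<H> \<times> UNIV) (\<lambda>(H, a). closest_point (scaled_feasible bs \<gamma> \<sigma> s H) a)"
proof (rule closest_point_continuous_on_set_map)
  show "convex (scaled_feasible bs \<gamma> \<sigma> s H)" for H
    by (rule convex_scaled_feasible) (rule \<gamma>)
  show "scaled_feasible bs \<gamma> \<sigma> s H \<noteq> {}" if "H \<in> \<H>" for H
    using joint_feasible_nonempty[OF \<gamma> \<sigma> sf[OF that]] by (simp add: scaled_feasible_def)
  show "x \<in> scaled_feasible bs \<gamma> \<sigma> s H"
    if x: "\<And>n. xn n \<in> scaled_feasible bs \<gamma> \<sigma> s (Hn n)" and lim: "Hn \<longlonglongrightarrow> H" "xn \<longlonglongrightarrow> x"
    for H x Hn xn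
  proof -
    have "stretch (1 / s) (xn n) \<in> joint_feasible bs \<gamma> \<sigma> (Hn n)" for n
      using x[of n] by (auto simp: scaled_feasible_def stretch_inverse[OF s])
    then have mem: "(Hn n, stretch (1 / s) (xn n)) \<in> {(H, x). x \<in> joint_feasible bs \<gamma> \<sigma> H}" for n
      by simp
    have "(\<lambda>n. stretch (1 / s) (xn n)) \<longlonglongrightarrow> stretch (1 / s) x"
      unfolding stretch_def case_prod_unfold by (intro tendsto_intros lim)
    then have lim': "(\<lambda>n. (Hn n, stretch (1 / s) (xn n))) \<longlonglongrightarrow> (H, stretch (1 / s) x)"
      by (intro tendsto_Pair lim)
    have "(H, stretch (1 / s) x) \<in> {(H, x). x \<in> joint_feasible bs \<gamma> \<sigma> H}"
      by (rule closed_sequentially[OF closed_joint_feasible_graph mem lim'], rule \<gamma>)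
    then have "stretch (1 / s) x \<in> joint_feasible bs \<gamma> \<sigma> H" by simp
    then have "stretch s (stretch (1 / s) x) \<in> scaled_feasible bs \<gamma> \<sigma> s H"
      unfolding scaled_feasible_def by (rule imageI)
    then show ?thesis by (simp only: stretch_inverse[OF s])
  qed
  show "eventually (\<lambda>H'. \<exists>y\<in>scaled_feasible bs \<gamma> \<sigma> s H'. dist y x < e) (at H within \<H>)"
    if x: "x \<in> scaled_feasible bs \<gamma> \<sigma> s H" and e: "e > 0" for H x e
  proof -
    obtain z where z: "z \<in> joint_feasible bs \<gamma> \<sigma> H" "x = stretch s z"
      using x by (auto simp: scaled_feasible_def)
    obtain M where M: "M > 0" "\<And>v :: (complex^'n^'k) \<times> (real^('b \<times> 'b \<times> 'k)). norm (stretch s v) \<le> M * norm v"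
      using linear_bounded_pos[OF linear_stretch] by blast
    have "eventually (\<lambda>H'. \<exists>y\<in>joint_feasible bs \<gamma> \<sigma> H'. dist y z < e / M) (nhds H)"
      using e M(1) by (intro joint_feasible_lower_hemicontinuous[OF \<gamma> \<sigma> z(1)]) simp
    then have "eventually (\<lambda>H'. \<exists>y\<in>scaled_feasible bs \<gamma> \<sigma> s H'. dist y x < e) (nhds H)"
    proof eventually_elim
      case (elim H')
      then obtain y where y: "y \<in> joint_feasible bs \<gamma> \<sigma> H'" "dist y z < e / M" by blast
      have "dist (stretch s y) x \<le> M * dist y z"
        using M(2)[of "y - z"] by (simp add: z dist_norm linear_diff[OF linear_stretch])
      also have "\<dots> < e" using y(2) M(1) by (simp add: field_simps)
      finally show ?case using y(1) by (auto simp: scaled_feasible_def)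
    qed
    then show ?thesis by (auto simp: eventually_at_filter elim: eventually_mono)
  qed
qed

text \<open>
  Since the cost is a squared distance up to a constant, minimizing it over a nonempty closed convex
  set means projecting, which also settles that the minimizer exists and is unique.
\<close>

lemma local_minimizers_iff_projection:
  fixes bs :: "'k::finite \<Rightarrow> 'b::finite" and H :: "complex^'n::finite^'k^'b"
  assumes \<gamma>: "\<And>k. \<gamma> k > 0" and \<sigma>: "\<And>k. (\<sigma> k)\<^sup>2 > 0" and \<rho>: "\<rho> > 0"
    and sf: "strictly_feasible bs \<gamma> \<sigma> H"
  defines "s \<equiv> sqrt (\<rho> / 2)"
  shows "(\<forall>b. is_arg_min (local_cost bs \<rho> \<tau> \<nu> b) (local_feasible bs \<gamma> \<sigma> H b) (W, block b t)) \<longleftrightarrow>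
    stretch s (W, t) =
      closest_point (scaled_feasible bs \<gamma> \<sigma> s H) (stretch s (0, copy_matrix bs *v \<tau> - \<nu> /\<^sub>R \<rho>))"
    (is "?L \<longleftrightarrow> _ = closest_point ?K ?a")
proof -
  have s: "s \<noteq> 0" using \<rho> by (simp add: s_def)
  have inj: "stretch s x \<in> ?K \<longleftrightarrow> x \<in> joint_feasible bs \<gamma> \<sigma> H" for x
    unfolding scaled_feasible_def
    by (rule inj_image_mem_iff[OF inj_stretch[OF s]])
  have convex: "convex ?K"
    by (rule convex_scaled_feasible) (rule \<gamma>)
  have "closed (Pair H -` {(H, x). x \<in> joint_feasible bs \<gamma> \<sigma> H})"
    by (intro closed_vimage closed_joint_feasible_graph \<gamma> continuous_intros)
  then have "closed (joint_feasible bs \<gamma> \<sigma> H)" by (simp add: vimage_def)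
  then have closed: "closed ?K"
    unfolding scaled_feasible_def by (intro closed_injective_linear_image linear_stretch inj_stretch s)
  have ne: "?K \<noteq> {}" using joint_feasible_nonempty[OF \<gamma> \<sigma> sf] by (simp add: scaled_feasible_def)
  have cost: "(case y of (W, t) \<Rightarrow> \<Sum>b\<in>UNIV. local_cost bs \<rho> \<tau> \<nu> b (W, block b t)) =
      (dist ?a (stretch s y))\<^sup>2 - (norm \<nu>)\<^sup>2 / (2 * \<rho>)" for y :: "(complex^'n^'k) \<times> _"
    unfolding s_def case_prod_unfold joint_cost_eq_dist[OF \<rho>] by simp
  have le: "u\<^sup>2 - c \<le> v\<^sup>2 - c \<longleftrightarrow> u \<le> v" if "u \<ge> 0" "v \<ge> 0" for u v c :: real
    using that by simp
  have "?L \<longleftrightarrow> (W, t) \<in> joint_feasible bs \<gamma> \<sigma> H \<and>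
      (\<forall>y\<in>joint_feasible bs \<gamma> \<sigma> H. dist ?a (stretch s (W, t)) \<le> dist ?a (stretch s y))"
    unfolding local_minimizers_iff_joint_minimizer cost le[OF zero_le_dist zero_le_dist] ..
  also have "\<dots> \<longleftrightarrow> stretch s (W, t) \<in> ?K \<and> (\<forall>y\<in>?K. dist ?a (stretch s (W, t)) \<le> dist ?a y)"
    unfolding inj unfolding scaled_feasible_def by (simp only: ball_simps)
  also have "\<dots> \<longleftrightarrow> stretch s (W, t) = closest_point ?K ?a"
  proof
    assume "stretch s (W, t) \<in> ?K \<and> (\<forall>y\<in>?K. dist ?a (stretch s (W, t)) \<le> dist ?a y)"
    then show "stretch s (W, t) = closest_point ?K ?a"
      by (intro closest_point_unique[OF convex closed]) auto
  next
    assume "stretch s (W, t) = closest_point ?K ?a"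
    then show "stretch s (W, t) \<in> ?K \<and> (\<forall>y\<in>?K. dist ?a (stretch s (W, t)) \<le> dist ?a y)"
      using closest_point_in_set[OF closed ne] closest_point_le[OF closed] by simp
  qed
  finally show ?thesis .
qed

lemma dual_update_iff:
  fixes \<nu> :: "real^('i::finite \<times> 'j::finite)"
  shows "(\<forall>b. block b \<nu>' = block b \<nu> + \<rho> *\<^sub>R (block b t - block b A *v \<tau>)) \<longleftrightarrow>
    \<nu>' = \<nu> + \<rho> *\<^sub>R (t - A *v \<tau>)"
proof -
  have "block b \<nu> + \<rho> *\<^sub>R (block b t - block b A *v \<tau>) = block b (\<nu> + \<rho> *\<^sub>R (t - A *v \<tau>))" for b
    unfolding block_copy_mult by (simp add: block_def vec_eq_iff)
  moreover have "(\<forall>b. block b x = block b y) \<longleftrightarrow> x = y" for x y :: "real^('i \<times> 'j)"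
    by (simp add: block_def vec_eq_iff)
  ultimately show ?thesis by simp
qed

theorem lemma5:
  fixes bs :: "'k::finite \<Rightarrow> 'b::finite"
    and \<gamma> \<sigma> :: "'k \<Rightarrow> real"
    and \<rho> :: real
    and \<H> :: "(complex^'n::finite^'k^'b) set"
  assumes "\<And>k. (\<sigma> k)\<^sup>2 > 0"
    and "\<And>k. \<gamma> k > 0"
    and "\<rho> > 0"
    and "compact \<H>"
    and "\<And>H. H \<in> \<H> \<Longrightarrow> strictly_feasible bs \<gamma> \<sigma> H"
  shows "\<exists>Wf tf \<tau>f \<nu>f.
    continuous_on (\<H> \<times> tau_space bs \<times> t_space bs) Wf \<and>
    continuous_on (\<H> \<times> tau_space bs \<times> t_space bs) tf \<and>
    continuous_on (\<H> \<times> tau_space bs \<times> t_space bs) \<tau>f \<and>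
    continuous_on (\<H> \<times> tau_space bs \<times> t_space bs) \<nu>f \<and>
    (\<forall>H\<in>\<H>. \<forall>\<tau>\<in>tau_space bs. \<forall>\<nu>\<in>t_space bs. \<forall>W t \<tau>' \<nu>'.
      admm_iteration bs \<gamma> \<sigma> \<rho> H \<tau> \<nu> W t \<tau>' \<nu>' \<longleftrightarrow>
      W = Wf (H, \<tau>, \<nu>) \<and> t = tf (H, \<tau>, \<nu>) \<and> \<tau>' = \<tau>f (H, \<tau>, \<nu>) \<and> \<nu>' = \<nu>f (H, \<tau>, \<nu>))"
proof -
  define s where "s = sqrt (\<rho> / 2)"
  have s: "s \<noteq> 0" using assms(3) by (simp add: s_def)
  define target where "target = (\<lambda>(\<tau>, \<nu>). stretch s (0 :: complex^'n^'k, copy_matrix bs *v \<tau> - \<nu> /\<^sub>R \<rho>))"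
  define proj where "proj = (\<lambda>p. closest_point (scaled_feasible bs \<gamma> \<sigma> s (fst p)) (target (snd p)))"
  let ?D = "\<H> \<times> tau_space bs \<times> t_space bs"
  define Wf where "Wf = (\<lambda>p. fst (proj p))"
  define tf where "tf = (\<lambda>p. (1 / s) *\<^sub>R snd (proj p))"
  define \<tau>f where "\<tau>f = (\<lambda>p. pseudo_inverse (copy_matrix bs) *v tf p)"
  define \<nu>f where "\<nu>f = (\<lambda>p. snd (snd p) + \<rho> *\<^sub>R (tf p - copy_matrix bs *v \<tau>f p))"
  have cont_matrix: "continuous_on S (\<lambda>x. A *v f x)" if "continuous_on S f"
    for A :: "real^'i^'j" and f :: "_ \<Rightarrow> _" and S
    using continuous_on_compose2[OF linear_continuous_on[OF matrix_vector_mul_bounded_linear] that]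
    by auto
  have "continuous_on ?D (\<lambda>p. target (snd p))"
    unfolding target_def stretch_def case_prod_unfold
    by (auto intro!: continuous_intros cont_matrix)
  then have "continuous_on ?D (\<lambda>p. (fst p, target (snd p)))"
    by (intro continuous_intros)
  moreover have "continuous_on ((\<lambda>p. (fst p, target (snd p))) ` ?D)
      (\<lambda>(H, a). closest_point (scaled_feasible bs \<gamma> \<sigma> s H) a)"
    by (rule continuous_on_subset[OF continuous_projection_onto_scaled_feasible[OF assms(2,1,5) s]]) auto
  ultimately have "continuous_on ?D
      ((\<lambda>(H, a). closest_point (scaled_feasible bs \<gamma> \<sigma> s H) a) \<circ> (\<lambda>p. (fst p, target (snd p))))"
    by (rule continuous_on_compose)
  then have proj: "continuous_on ?D proj" by (simp add: proj_def comp_def)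
  have Wf: "continuous_on ?D Wf" and tf: "continuous_on ?D tf"
    unfolding Wf_def tf_def by (intro continuous_intros proj)+
  have \<tau>f: "continuous_on ?D \<tau>f" unfolding \<tau>f_def by (intro cont_matrix tf)
  have \<nu>f: "continuous_on ?D \<nu>f"
    unfolding \<nu>f_def by (intro continuous_intros cont_matrix tf \<tau>f)
  have "admm_iteration bs \<gamma> \<sigma> \<rho> H \<tau> \<nu> W t \<tau>' \<nu>' \<longleftrightarrow>
      W = Wf (H, \<tau>, \<nu>) \<and> t = tf (H, \<tau>, \<nu>) \<and> \<tau>' = \<tau>f (H, \<tau>, \<nu>) \<and> \<nu>' = \<nu>f (H, \<tau>, \<nu>)"
    if "H \<in> \<H>" for H \<tau> \<nu> W t \<tau>' \<nu>'
  proof -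
    have scale: "s *\<^sub>R t = v \<longleftrightarrow> t = (1 / s) *\<^sub>R v" for v
      using s by auto
    have "stretch s (W, t) = proj (H, \<tau>, \<nu>) \<longleftrightarrow> W = Wf (H, \<tau>, \<nu>) \<and> t = tf (H, \<tau>, \<nu>)"
      unfolding Wf_def tf_def by (simp add: stretch_def prod_eq_iff scale[symmetric])
    then show ?thesis
      unfolding admm_iteration_def dual_update_iff
        local_minimizers_iff_projection[OF assms(2,1,3) assms(5)[OF that], folded s_def]
      by (auto simp: proj_def target_def \<tau>f_def \<nu>f_def)
  qed
  with Wf tf \<tau>f \<nu>f show ?thesis by (intro exI[of _ Wf] exI[of _ tf] exI[of _ \<tau>f] exI[of _ \<nu>f]) simp
qed

end
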